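(* Let $E:0\to Y\stackrel{\imath}{\to}X\stackrel{\pi}{\to}Z\to 0$ be an extension of topological abelian groups. Suppose that $Y$ is a complete locally bounded topological vector space and $Z$ is a locally bounded topological vector space (each regarded as a topological abelian group in $E$). Then $X$ admits a topological vector space structure (i.e. a scalar multiplication $\mathbb{R}\times X\to X$ making $X$, with its given group operation and topology, a topological vector space) in such a way that $E$ becomes an extension of (locally bounded) topological vector spaces.
   Context: All topological groups are Hausdorff and abelian; all topological vector spaces are Hausdorff and over $\mathbb{R}$. A topological vector space is locally bounded if it has a bounded neighbourhood of zero. An extension of topological abelian groups is a short exact sequence $0\to Y\stackrel{\imath}{\to}X\stackrel{\pi}{\to}Z\to 0$ of topological abelian groups in which $\imath,\pi$ are continuous homomorphisms that are open onto their images. It is an extension of topological vector spaces if moreover $Y,X,Z$ are topological vector spaces and $\imath,\pi$ are linear. *)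

theory Defs
  imports "HOL-Analysis.Analysis"
begin

text \<open>
  Hausdorff topological abelian groups are types of class
  \<open>{topological_ab_group_add, t2_space}\<close>. Scalar multiplications are explicit functions,
  so that one can speak about the existence of a vector space structure on a given group.
\<close>

locale topological_vector_space = vector_space smul
  for smul :: "real \<Rightarrow> 'a::{topological_ab_group_add, t2_space} \<Rightarrow> 'a" +
  assumes continuous_smul: "continuous_on UNIV (\<lambda>(r, x). smul r x)"

definition tvs_bounded ::
  "(real \<Rightarrow> 'a::{topological_ab_group_add, t2_space} \<Rightarrow> 'a) \<Rightarrow> 'a set \<Rightarrow> bool" where
  "tvs_bounded smul B \<longleftrightarrow>
     (\<forall>U. open U \<and> 0 \<in> U \<longrightarrow> (\<exists>s>0. \<forall>t>s. B \<subseteq> smul t ` U))"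

definition locally_bounded_tvs ::
  "(real \<Rightarrow> 'a::{topological_ab_group_add, t2_space} \<Rightarrow> 'a) \<Rightarrow> bool" where
  "locally_bounded_tvs smul \<longleftrightarrow>
     topological_vector_space smul \<and> (\<exists>U. open U \<and> 0 \<in> U \<and> tvs_bounded smul U)"

definition open_onto_image :: "('a::topological_space \<Rightarrow> 'b::topological_space) \<Rightarrow> bool" where
  "open_onto_image f \<longleftrightarrow> open_map euclidean (top_of_set (range f)) f"

definition group_extension ::
  "('y::{topological_ab_group_add, t2_space} \<Rightarrow> 'x::{topological_ab_group_add, t2_space})
    \<Rightarrow> ('x \<Rightarrow> 'z::{topological_ab_group_add, t2_space}) \<Rightarrow> bool" where
  "group_extension i p \<longleftrightarrow>
     Modules.additive i \<and> continuous_on UNIV i \<and> open_onto_image i \<and>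
     Modules.additive p \<and> continuous_on UNIV p \<and> open_onto_image p \<and>
     inj i \<and> range i = {x. p x = 0} \<and> surj p"

definition tvs_extension ::
  "(real \<Rightarrow> 'y::{topological_ab_group_add, t2_space} \<Rightarrow> 'y)
    \<Rightarrow> (real \<Rightarrow> 'x::{topological_ab_group_add, t2_space} \<Rightarrow> 'x)
    \<Rightarrow> (real \<Rightarrow> 'z::{topological_ab_group_add, t2_space} \<Rightarrow> 'z)
    \<Rightarrow> ('y \<Rightarrow> 'x) \<Rightarrow> ('x \<Rightarrow> 'z) \<Rightarrow> bool" where
  "tvs_extension smulY smulX smulZ i p \<longleftrightarrow>
     group_extension i p \<and>
     topological_vector_space smulY \<and> topological_vector_space smulX \<and>
     topological_vector_space smulZ \<and>
     Vector_Spaces.linear smulY smulX i \<and> Vector_Spaces.linear smulX smulZ p"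

text \<open>
  Completeness of a topological group is completeness for its group uniformity. The class
  \<open>uniform_topological_group_add\<close> adds no data beyond the topological group:
  \<open>uniformity_eq_group\<close> below shows that the uniformity is determined by the
  neighbourhoods of zero.
\<close>

lemma uniformity_eq_group:
  "(uniformity :: ('a::uniform_topological_group_add \<times> 'a) filter) =
     filtercomap (\<lambda>(x, y). y - x) (nhds 0)"
  by (rule cauchy_seq_finset_iff_vanishing)

end

theory Submission
  imports Defs
begin

text \<open>
  A scalar multiplication that is continuous on a Hausdorff torsion-free group \<open>X\<close> is the same as
  a continuous one-parameter subgroup \<open>\<phi> : \<real> \<rightarrow> X\<close> with \<open>\<phi>(1) = x\<close> for every \<open>x\<close>, depending on \<open>x\<close> in
  an equicontinuous way for parameters in \<open>[-1, 1]\<close>. Uniqueness of such subgroups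
  (\<open>one_param_unique\<close>) makes the vector space axioms and the linearity of \<open>i\<close> and \<open>p\<close> automatic. So the
  problem is to lift the line \<open>t \<mapsto> t p(x)\<close> of \<open>Z\<close> to a subgroup of \<open>X\<close> through \<open>x\<close>.

  For small \<open>x\<close> the line lifts to a map \<open>s : \<real> \<rightarrow> X\<close> whose failure to be additive lies in a
  bounded subset of \<open>Y\<close>: choose small lifts for \<open>0 \<le> t < 1\<close> and add multiples of \<open>x\<close>
  for the integer part of \<open>t\<close>. By the Hyers--Ulam argument (\<open>bounded_cocycle_trivial\<close>), such a map is
  at bounded distance from an additive one: the limit of \<open>s(N\<^sup>n t) / N\<^sup>n\<close>. Division by \<open>N\<^sup>n\<close> is
  not available in \<open>X\<close>, but the limit differs from \<open>s(t)\<close> by a series whose terms lie in \<open>Y\<close>, where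
  one can divide and where completeness gives convergence. Since every
  neighbourhood of zero absorbs each point of \<open>Z\<close>, every \<open>x\<close> is the sum of a multiple of a small
  element and an element of \<open>Y\<close>, which gives the subgroups for all \<open>x\<close> (\<open>one_param_exists\<close>).

  The lifts produced in this way take values, for \<open>\<bar>t\<bar> \<le> 1\<close>, in one fixed set \<open>W + i(B + B)\<close>, the
  slab, where \<open>W\<close> is a neighbourhood of zero in \<open>X\<close> and \<open>B\<close> is bounded in \<open>Y\<close>. An element of \<open>X\<close> is
  small as soon as its image in \<open>Z\<close> is small and a large multiple of it lies in the slab
  (\<open>slab_criterion\<close>). This one fact yields the continuity of each lift, the equicontinuity in \<open>x\<close>,
  and the local boundedness of \<open>X\<close>.
\<close>

section \<open>Integer multiples and neighbourhoods of zero\<close>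

text \<open>
  An abelian group carries no scalars, but it is a module over the integers. At least one of the
  two sums below is empty.
\<close>

definition zmult :: "int \<Rightarrow> 'a::ab_group_add \<Rightarrow> 'a" where
  "zmult k x = (\<Sum>_\<in>{0..<k}. x) - (\<Sum>_\<in>{k..<0}. x)"

lemma zmult_add_one: "zmult (k + 1) x = zmult k x + x"
proof (cases "k \<ge> 0")
  case True
  then have "{0..<k+1} = insert k {0..<k}" "{k+1..<0} = {}" "{k..<0} = {}"
    by auto
  then show ?thesis
    by (simp add: zmult_def)
next
  case False
  then have "{k..<0} = insert k {k+1..<0}" "{0..<k+1} = {}" "{0..<k} = {}"
    by auto
  then show ?thesis
    by (simp add: zmult_def)
qed

lemma module_zmult: "module (zmult :: int \<Rightarrow> 'a::ab_group_add \<Rightarrow> 'a)"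
proof
  fix j k :: int and x y :: 'a
  show "zmult k (x + y) = zmult k x + zmult k y"
    by (simp add: zmult_def sum.distrib)
  have zero: "zmult 0 x = 0" for x :: 'a
    by (simp add: zmult_def)
  then show one: "zmult 1 x = x" for x :: 'a
    using zmult_add_one[of 0 x] by simp
  have diff_one: "zmult (k - 1) x = zmult k x - x" for k and x :: 'a
    using zmult_add_one[of "k - 1" x] by simp
  show distrib: "zmult (j + k) x = zmult j x + zmult k x" for j k and x :: 'a
  proof (induction k rule: int_induct[where k = 0])
    case base
    then show ?case by (simp add: zero)
  next
    case (step1 k)
    then show ?case
      using zmult_add_one[of "j + k" x] zmult_add_one[of k x] by (simp add: algebra_simps)
  next
    case (step2 k)
    then show ?case
      using diff_one[of "j + k" x] diff_one[of k x] by (simp add: add_diff_eq)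
  qed
  show "zmult j (zmult k x) = zmult (j * k) x"
  proof (induction j rule: int_induct[where k = 0])
    case base
    then show ?case by (simp add: zero)
  next
    case (step1 j)
    then show ?case
      by (simp add: one distrib distrib_right)
  next
    case (step2 j)
    have "zmult (j * k) x = zmult ((j - 1) * k) x + zmult k x"
      using distrib[of "(j - 1) * k" k x] by (simp add: left_diff_distrib)
    with step2 show ?case
      by (simp add: diff_one)
  qed
qed

interpretation zmult: module "zmult :: int \<Rightarrow> 'a::ab_group_add \<Rightarrow> 'a"
  by (rule module_zmult)

lemma additive_zmult: "Modules.additive f \<Longrightarrow> f (zmult k x) = zmult k (f x)"
  by (simp add: zmult_def additive.diff additive.sum)

lemma (in vector_space) scale_of_int: "scale (of_int k) x = zmult k x"
proof -
  have "Modules.additive (\<lambda>a. scale a x)"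
    by standard (rule scale_left_distrib)
  moreover have "zmult k 1 = (of_int k :: 'a)"
    by (cases "k \<ge> 0") (auto simp: zmult_def)
  ultimately show ?thesis
    using additive_zmult[of "\<lambda>a. scale a x" k 1] by simp
qed

lemma zmult_real: "zmult k (t::real) = of_int k * t"
  by (cases "k \<ge> 0") (auto simp: zmult_def)

lemma continuous_on_zmult:
  "continuous_on UNIV (zmult k :: 'a::topological_ab_group_add \<Rightarrow> 'a)"
  unfolding zmult_def by (intro continuous_intros)

definition sym_nbhd :: "'a::topological_ab_group_add set \<Rightarrow> bool" where
  "sym_nbhd V \<longleftrightarrow> open V \<and> 0 \<in> V \<and> (\<forall>v\<in>V. - v \<in> V)"

lemma sym_nbhdD:
  assumes "sym_nbhd V"
  shows "open V" "0 \<in> V" "v \<in> V \<Longrightarrow> - v \<in> V"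
  using assms by (auto simp: sym_nbhd_def)

lemma sym_nbhd_subset:
  fixes U :: "'a::topological_ab_group_add set"
  assumes "open U" "0 \<in> U"
  obtains V where "sym_nbhd V" "V \<subseteq> U"
proof
  have "open (uminus -` U)"
    by (rule open_vimage[OF assms(1)]) (intro continuous_intros)
  then show "sym_nbhd (U \<inter> uminus -` U)"
    using assms by (auto simp: sym_nbhd_def)
qed auto

lemma sym_nbhd_add:
  fixes U :: "'a::topological_ab_group_add set"
  assumes "open U" "0 \<in> U"
  obtains V where "sym_nbhd V" "\<And>v w. v \<in> V \<Longrightarrow> w \<in> V \<Longrightarrow> v + w \<in> U"
proof -
  have "open ((\<lambda>z. fst z + snd z) -` U)"
    by (rule open_vimage[OF assms(1)]) (intro continuous_intros)
  moreover have "(0, 0) \<in> (\<lambda>z. fst z + snd z) -` U"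
    using assms by simp
  ultimately obtain A A' where A: "open A" "open A'" "(0, 0) \<in> A \<times> A'"
    "A \<times> A' \<subseteq> (\<lambda>z. fst z + snd z) -` U"
    by (rule open_prod_elim)
  obtain V where "sym_nbhd V" "V \<subseteq> A \<inter> A'"
    using sym_nbhd_subset[of "A \<inter> A'"] A by auto
  then have "(v, w) \<in> (\<lambda>z. fst z + snd z) -` U" if "v \<in> V" "w \<in> V" for v w
    using A(4) that by blast
  then show ?thesis
    using \<open>sym_nbhd V\<close> by (intro that[of V]) auto
qed

lemma sym_nbhd_zmult:
  fixes U :: "'a::topological_ab_group_add set"
  assumes "open U" "0 \<in> U"
  obtains V where "sym_nbhd V" "\<And>k v. 0 \<le> k \<Longrightarrow> k \<le> N \<Longrightarrow> v \<in> V \<Longrightarrow> zmult k v \<in> U"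
proof -
  have "open (\<Inter>k\<in>{0..N}. zmult k -` U)"
    using open_vimage[OF assms(1) continuous_on_zmult] by (intro open_INT) auto
  moreover have "0 \<in> (\<Inter>k\<in>{0..N}. zmult k -` U)"
    using assms by simp
  ultimately obtain V where "sym_nbhd V" "V \<subseteq> (\<Inter>k\<in>{0..N}. zmult k -` U)"
    by (rule sym_nbhd_subset)
  then show ?thesis
    by (intro that[of V]) auto
qed

lemma continuous_on_additiveI:
  fixes f :: "'a::topological_ab_group_add \<Rightarrow> 'b::topological_ab_group_add"
  assumes f: "Modules.additive f"
    and at_0: "\<And>U. open U \<Longrightarrow> 0 \<in> U \<Longrightarrow> \<exists>V. open V \<and> 0 \<in> V \<and> (\<forall>v\<in>V. f v \<in> U)"
  shows "continuous_on UNIV f"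
proof -
  have "(f \<longlongrightarrow> f x) (nhds x)" for x
  proof -
    have "(f \<longlongrightarrow> 0) (nhds 0)"
      using at_0 by (intro topological_tendstoI) (fastforce simp: eventually_nhds)
    moreover have "((\<lambda>y. y - x) \<longlongrightarrow> x - x) (nhds x)"
      by (intro tendsto_intros filterlim_ident)
    ultimately have "((\<lambda>y. f (y - x)) \<longlongrightarrow> 0) (nhds x)"
      using filterlim_compose[of f "nhds 0" "nhds 0" "\<lambda>y. y - x" "nhds x"] by simp
    then have "((\<lambda>y. f (y - x) + f x) \<longlongrightarrow> 0 + f x) (nhds x)"
      by (intro tendsto_intros)
    then show ?thesis
      by (simp add: additive.diff[OF f])
  qed
  then show ?thesis
    by (auto simp: continuous_on_def intro: tendsto_mono[OF at_within_le_nhds])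
qed


section \<open>Bounded sets in topological vector spaces\<close>

context topological_vector_space
begin

lemma tendsto_smul:
  assumes "(f \<longlongrightarrow> r) F" "(g \<longlongrightarrow> x) F"
  shows "((\<lambda>t. smul (f t) (g t)) \<longlongrightarrow> smul r x) F"
proof -
  have "isCont (\<lambda>(r, x). smul r x) (r, x)"
    using continuous_smul by (simp add: continuous_on_eq_continuous_at)
  from isCont_tendsto_compose[OF this tendsto_Pair[OF assms]] show ?thesis
    by simp
qed

lemma balanced_nbhd:
  assumes "open U" "0 \<in> U"
  obtains V where "open V" "0 \<in> V" "\<And>r v. v \<in> V \<Longrightarrow> \<bar>r\<bar> \<le> 1 \<Longrightarrow> smul r v \<in> U"
proof -
  have "open ((\<lambda>(r, x). smul r x) -` U)" "(0, 0) \<in> (\<lambda>(r, x). smul r x) -` U"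
    using open_vimage[OF assms(1) continuous_smul] assms(2) by auto
  then obtain R G where RO: "open R" "open G" "(0, 0) \<in> R \<times> G"
    "R \<times> G \<subseteq> (\<lambda>(r, x). smul r x) -` U"
    by (rule open_prod_elim)
  then obtain \<delta> where "\<delta> > 0" and \<delta>: "\<And>r. \<bar>r\<bar> < \<delta> \<Longrightarrow> r \<in> R"
    unfolding open_dist by (fastforce simp: dist_real_def)
  have "continuous_on UNIV (smul (2 / \<delta>))"
    by (auto simp: continuous_on_def intro!: tendsto_smul tendsto_intros)
  then have "open (smul (2 / \<delta>) -` G)"
    by (rule open_vimage[OF RO(2)])
  moreover have "smul r v \<in> U" if "v \<in> smul (2 / \<delta>) -` G" "\<bar>r\<bar> \<le> 1" for r v
  proof -
    have "\<bar>r * \<delta> / 2\<bar> < \<delta>"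
      using that(2) \<open>\<delta> > 0\<close> by (simp add: abs_mult divide_simps)
    then have "(r * \<delta> / 2, smul (2 / \<delta>) v) \<in> R \<times> G"
      using \<delta> that(1) by simp
    from subsetD[OF RO(4) this] have "smul (r * \<delta> / 2) (smul (2 / \<delta>) v) \<in> U"
      by simp
    then show ?thesis
      using \<open>\<delta> > 0\<close> by simp
  qed
  ultimately show ?thesis
    using RO(3) by (intro that[of "smul (2 / \<delta>) -` G"]) auto
qed

lemma tvs_bounded_iff:
  "tvs_bounded smul B \<longleftrightarrow>
     (\<forall>U. open U \<and> 0 \<in> U \<longrightarrow> (\<exists>s>0. \<forall>t>s. \<forall>b\<in>B. smul (inverse t) b \<in> U))"
proof -
  have "B \<subseteq> smul t ` U \<longleftrightarrow> (\<forall>b\<in>B. smul (inverse t) b \<in> U)" if "t > 0" for t U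
  proof
    assume "\<forall>b\<in>B. smul (inverse t) b \<in> U"
    moreover have "b = smul t (smul (inverse t) b)" for b
      using that by simp
    ultimately show "B \<subseteq> smul t ` U"
      by blast
  qed (use that in auto)
  then have "(\<exists>s>0. \<forall>t>s. B \<subseteq> smul t ` U) \<longleftrightarrow>
      (\<exists>s>0. \<forall>t>s. \<forall>b\<in>B. smul (inverse t) b \<in> U)" for U
    by (metis less_trans)
  then show ?thesis
    by (simp add: tvs_bounded_def)
qed

lemma tvs_boundedD:
  assumes "tvs_bounded smul B" "open U" "0 \<in> U"
  obtains s where "s > 0" "\<And>t b. t > s \<Longrightarrow> b \<in> B \<Longrightarrow> smul (inverse t) b \<in> U"
  using assms unfolding tvs_bounded_iff by meson

lemma tvs_bounded_subset: "tvs_bounded smul B \<Longrightarrow> A \<subseteq> B \<Longrightarrow> tvs_bounded smul A"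
  unfolding tvs_bounded_iff by (meson subsetD)

lemma tvs_bounded_add:
  assumes "tvs_bounded smul A" "tvs_bounded smul B"
  shows "tvs_bounded smul {a + b |a b. a \<in> A \<and> b \<in> B}"
  unfolding tvs_bounded_iff
proof (intro allI impI)
  fix U :: "'a set" assume U: "open U \<and> 0 \<in> U"
  then obtain V where V: "sym_nbhd V" "\<And>v w. v \<in> V \<Longrightarrow> w \<in> V \<Longrightarrow> v + w \<in> U"
    using sym_nbhd_add by blast
  obtain s where s: "s > 0" "\<And>t b. t > s \<Longrightarrow> b \<in> A \<Longrightarrow> smul (inverse t) b \<in> V"
    using tvs_boundedD[OF assms(1), of V] V(1) by (auto simp: sym_nbhd_def)
  obtain s' where s': "s' > 0" "\<And>t b. t > s' \<Longrightarrow> b \<in> B \<Longrightarrow> smul (inverse t) b \<in> V"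
    using tvs_boundedD[OF assms(2), of V] V(1) by (auto simp: sym_nbhd_def)
  show "\<exists>s>0. \<forall>t>s. \<forall>b\<in>{a + b |a b. a \<in> A \<and> b \<in> B}. smul (inverse t) b \<in> U"
    using s s' V(2) by (intro exI[of _ "max s s'"]) (auto simp: scale_right_distrib)
qed

lemma tvs_bounded_singleton: "tvs_bounded smul {x}"
  unfolding tvs_bounded_iff
proof (intro allI impI)
  fix U :: "'a set" assume U: "open U \<and> 0 \<in> U"
  have "((\<lambda>t. smul (inverse t) x) \<longlongrightarrow> smul 0 x) at_top"
    by (intro tendsto_smul tendsto_inverse_0_at_top filterlim_ident tendsto_const)
  then have "\<forall>\<^sub>F t in at_top. smul (inverse t) x \<in> U"
    using U by (auto dest: topological_tendstoD)
  then obtain s where "\<And>t. t \<ge> s \<Longrightarrow> smul (inverse t) x \<in> U"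
    unfolding eventually_at_top_linorder by blast
  then show "\<exists>s>0. \<forall>t>s. \<forall>b\<in>{x}. smul (inverse t) b \<in> U"
    by (intro exI[of _ "max s 1"]) auto
qed

lemma bounded_inverse_powers:
  assumes "tvs_bounded smul B" "r \<ge> 2" "\<And>n. f n \<in> B"
  shows "(\<lambda>n. smul (inverse (r ^ n)) (f n)) \<longlonglongrightarrow> 0"
proof (rule topological_tendstoI)
  fix U :: "'a set" assume "open U" "0 \<in> U"
  then obtain s where s: "s > 0" "\<And>t b. t > s \<Longrightarrow> b \<in> B \<Longrightarrow> smul (inverse t) b \<in> U"
    using tvs_boundedD[OF assms(1)] by blast
  obtain n0 where "s < r ^ n0"
    using real_arch_pow[of r s] assms(2) by auto
  then have "s < r ^ n" if "n \<ge> n0" for n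
    using power_increasing[OF that, of r] assms(2) by linarith
  then have "\<forall>\<^sub>F n in sequentially. r ^ n > s"
    by (auto simp: eventually_sequentially)
  then show "\<forall>\<^sub>F n in sequentially. smul (inverse (r ^ n)) (f n) \<in> U"
    by eventually_elim (use s assms(3) in auto)
qed

end

text \<open>
  Write \<open>r x - r\<^sub>0 x\<^sub>0\<close> as \<open>r (x - x\<^sub>0) + (r - r\<^sub>0) x\<^sub>0\<close>. The second term is small by continuity along
  lines. For the first, \<open>r\<close> stays below an integer \<open>m\<close> in absolute value, and
  \<open>r (x - x\<^sub>0) = (r / m) (m (x - x\<^sub>0))\<close> is small by equicontinuity of the scalars in \<open>[-1, 1]\<close>, since
  multiplication by \<open>m\<close> is continuous in every topological abelian group.
\<close>

lemma topological_vector_spaceI: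
  fixes smul :: "real \<Rightarrow> 'a::{topological_ab_group_add, t2_space} \<Rightarrow> 'a"
  assumes "vector_space smul"
    and line: "\<And>x. continuous_on UNIV (\<lambda>r. smul r x)"
    and equicont: "\<And>U. open U \<Longrightarrow> 0 \<in> U \<Longrightarrow>
      \<exists>V. open V \<and> 0 \<in> V \<and> (\<forall>v\<in>V. \<forall>r. \<bar>r\<bar> \<le> 1 \<longrightarrow> smul r v \<in> U)"
  shows "topological_vector_space smul"
proof -
  interpret vector_space smul by fact
  have "((\<lambda>z. smul (fst z) (snd z)) \<longlongrightarrow> smul r x) (nhds (r, x))" for r x
  proof -
    have fst: "(fst \<longlongrightarrow> r) (nhds (r, x))" and snd: "(snd \<longlongrightarrow> x) (nhds (r, x))"
      using tendsto_fst[OF filterlim_ident[of "nhds (r, x)"]]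
        tendsto_snd[OF filterlim_ident[of "nhds (r, x)"]]
      by (auto simp: filterlim_def)
    have "isCont (\<lambda>t. smul t x) r"
      using line by (simp add: continuous_on_eq_continuous_at)
    then have r: "((\<lambda>z. smul (fst z) x) \<longlongrightarrow> smul r x) (nhds (r, x))"
      by (rule isCont_tendsto_compose[OF _ fst])
    have x: "((\<lambda>z. smul (fst z) (snd z - x)) \<longlongrightarrow> 0) (nhds (r, x))"
    proof (rule topological_tendstoI)
      fix U :: "'a set" assume "open U" "0 \<in> U"
      then obtain V where V: "open V" "0 \<in> V" "\<And>v t. v \<in> V \<Longrightarrow> \<bar>t\<bar> \<le> 1 \<Longrightarrow> smul t v \<in> U"
        using equicont[of U] by auto
      define m where "m = \<lceil>\<bar>r\<bar>\<rceil> + 1"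
      have m: "\<bar>r\<bar> < of_int m" "m > 0"
        unfolding m_def by linarith+
      have "open (zmult m -` V)"
        by (rule open_vimage[OF V(1) continuous_on_zmult])
      moreover have "((\<lambda>z. snd z - x) \<longlongrightarrow> x - x) (nhds (r, x))"
        by (intro tendsto_intros snd)
      ultimately have "\<forall>\<^sub>F z in nhds (r, x). snd z - x \<in> zmult m -` V"
        using V(2) by (intro topological_tendstoD[of _ "x - x"]) auto
      moreover have "\<forall>\<^sub>F z in nhds (r, x). \<bar>fst z\<bar> < of_int m"
        using m(1) by (intro order_tendstoD(2)[OF tendsto_rabs[OF fst]])
      ultimately show "\<forall>\<^sub>F z in nhds (r, x). smul (fst z) (snd z - x) \<in> U"
      proof eventually_elim
        case (elim z)
        have "smul (fst z / of_int m) (zmult m (snd z - x)) \<in> U"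
          using elim m by (intro V(3)) (auto simp: divide_simps)
        then show ?case
          using m(2) by (simp flip: scale_of_int)
      qed
    qed
    show ?thesis
      using tendsto_add[OF x r] by (simp add: scale_right_diff_distrib)
  qed
  then have "continuous_on UNIV (\<lambda>z. smul (fst z) (snd z))"
    by (auto simp: continuous_on_def intro: tendsto_mono[OF at_within_le_nhds])
  then show ?thesis
    by unfold_locales (simp add: case_prod_unfold)
qed

section \<open>Trivialising a bounded cocycle\<close>

lemma complete_Cauchy_limit:
  fixes a :: "nat \<Rightarrow> 'y::{topological_ab_group_add, uniform_topological_group_add, t2_space}"
  assumes "complete (UNIV :: 'y set)"
    and "\<And>U. open U \<Longrightarrow> 0 \<in> U \<Longrightarrow> \<exists>n0. \<forall>n\<ge>n0. \<forall>m\<ge>n0. a m - a n \<in> U"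
  obtains l where "a \<longlonglongrightarrow> l"
proof -
  have "Cauchy a"
    unfolding Cauchy_uniform_iff
  proof (intro allI impI)
    fix P :: "'y \<times> 'y \<Rightarrow> bool" assume "eventually P uniformity"
    then obtain Q where Q: "eventually Q (nhds 0)" "\<And>x y. Q (y - x) \<Longrightarrow> P (x, y)"
      unfolding uniformity_eq_group eventually_filtercomap by fastforce
    then obtain U where U: "open U" "0 \<in> U" "\<And>u. u \<in> U \<Longrightarrow> Q u"
      by (auto simp: eventually_nhds)
    from assms(2)[OF U(1,2)] show "\<exists>N. \<forall>n\<ge>N. \<forall>m\<ge>N. P (a n, a m)"
      using U(3) Q(2) by fast
  qed
  then obtain l where "filtermap a sequentially \<le> nhds l"
    using cauchy_filter_complete_converges[of "filtermap a sequentially" UNIV] assms(1)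
    by (auto simp: Cauchy_uniform filtermap_bot_iff)
  then show ?thesis
    by (intro that[of l]) (simp add: filterlim_def)
qed

text \<open>
  The Hyers--Ulam argument. The relation between \<open>D\<close> and \<open>d\<close> holds whenever
  \<open>D g h = s (g + h) - s g - s h\<close> and \<open>d g = N s(g) - s(N g)\<close> for some map \<open>s\<close>, even if \<open>s\<close> takes values
  in a larger group and only these differences lie in the complete space. The series
  \<open>c g = d(g) / N + d(N g) / N\<^sup>2 + d(N\<^sup>2 g) / N\<^sup>3 + \<dots>\<close> converges because \<open>d\<close> is bounded, and the relation
  makes the partial sums of \<open>c (g + h) - c g - c h\<close> telescope to
  \<open>D g h - D (N\<^sup>n g) (N\<^sup>n h) / N\<^sup>n\<close>, which tends to \<open>D g h\<close>.

  The condition \<open>(B + B) / N \<subseteq> B\<close> replaces local convexity: it keeps all partial sums inside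
  \<open>B\<close>.
\<close>

lemma bounded_cocycle_trivial:
  fixes smul :: "real \<Rightarrow> 'y::{topological_ab_group_add, uniform_topological_group_add, t2_space} \<Rightarrow> 'y"
    and d :: "'g::ab_group_add \<Rightarrow> 'y" and D :: "'g \<Rightarrow> 'g \<Rightarrow> 'y" and N :: int
  assumes "topological_vector_space smul"
    and complete: "complete (UNIV :: 'y set)"
    and B: "sym_nbhd B" "tvs_bounded smul B"
    and N: "N \<ge> 2" "\<And>a b. a \<in> B \<Longrightarrow> b \<in> B \<Longrightarrow> smul (inverse (of_int N)) (a + b) \<in> B"
    and d: "\<And>g. d g \<in> B" and D: "\<And>g h. D g h \<in> B"
    and d_D: "\<And>g h. zmult N (D g h) - D (zmult N g) (zmult N h) = d (g + h) - d g - d h"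
  obtains c where "\<And>g h. c (g + h) = c g + c h + D g h"
    and "\<And>g. \<exists>a\<in>B. \<exists>b\<in>B. c g = a + b"
    and "\<And>g. \<forall>n. d (zmult (N ^ n) g) = 0 \<Longrightarrow> c g = 0"
proof -
  interpret topological_vector_space smul by fact
  define q :: real where "q = inverse (of_int N)"
  have q: "q ^ n = inverse (of_int N ^ n)" for n
    by (simp add: q_def power_inverse)
  have sum_in_B: "(\<Sum>j<n. smul (q ^ Suc j) (e j)) \<in> B" if "\<And>j. e j \<in> B" for n and e :: "nat \<Rightarrow> 'y"
    using that
  proof (induction n arbitrary: e)
    case 0
    then show ?case using B by (simp add: sym_nbhd_def)
  next
    case (Suc n)
    \<comment> \<open>Horner scheme: each step applies the map \<open>(a, b) \<mapsto> (a + b) / N\<close> of \<open>B \<times> B\<close> into \<open>B\<close>.\<close>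
    have "(\<Sum>j<Suc n. smul (q ^ Suc j) (e j)) = smul q (e 0 + (\<Sum>j<n. smul (q ^ Suc j) (e (Suc j))))"
      by (simp add: sum.lessThan_Suc_shift scale_right_distrib scale_sum_right del: sum.lessThan_Suc)
    also have "\<dots> \<in> B"
      using N(2)[OF Suc.prems(1) Suc.IH[of "\<lambda>j. e (Suc j)"]] Suc.prems by (simp add: q_def)
    finally show ?case .
  qed
  define a where "a g n = (\<Sum>j<n. smul (q ^ Suc j) (d (zmult (N ^ j) g)))" for g n
  have a_diff: "\<exists>b\<in>B. a g (n + m) - a g n = smul (q ^ n) b" for g n m
  proof
    let ?b = "\<Sum>j<m. smul (q ^ Suc j) (d (zmult (N ^ (n + j)) g))"
    show "?b \<in> B"
      by (rule sum_in_B) (rule d)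
    have "a g (n + m) =
        a g n + smul (q ^ n) (\<Sum>j<m. smul (q ^ Suc j) (d (zmult (N ^ (n + j)) g)))" for m
      by (induction m) (auto simp: a_def scale_right_distrib scale_sum_right power_add mult_ac)
    then show "a g (n + m) - a g n = smul (q ^ n) ?b"
      by simp
  qed
  have "\<exists>l. a g \<longlonglongrightarrow> l" for g
  proof -
    have "\<exists>n0. \<forall>n\<ge>n0. \<forall>m\<ge>n0. a g m - a g n \<in> U" if U: "open U" "0 \<in> U" for U
    proof -
      obtain V where V: "sym_nbhd V" "\<And>v w. v \<in> V \<Longrightarrow> w \<in> V \<Longrightarrow> v + w \<in> U"
        using sym_nbhd_add[OF U] by metis
      obtain s where s: "s > 0" "\<And>t b. t > s \<Longrightarrow> b \<in> B \<Longrightarrow> smul (inverse t) b \<in> V"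
        using tvs_boundedD[OF B(2) sym_nbhdD(1,2)[OF V(1)]] by metis
      obtain n0 where "s < of_int N ^ n0"
        using real_arch_pow[of "of_int N" s] N(1) by auto
      then have n0: "a g m - a g n0 \<in> V" if "m \<ge> n0" for m
        using s(2) a_diff[of g n0 "m - n0"] that by (auto simp: q)
      show ?thesis
      proof (intro exI allI impI)
        fix n m assume "n0 \<le> n" "n0 \<le> m"
        then have "(a g m - a g n0) + - (a g n - a g n0) \<in> U"
          by (intro V(2) sym_nbhdD(3)[OF V(1)] n0)
        then show "a g m - a g n \<in> U"
          by simp
      qed
    qed
    then show ?thesis
      using complete_Cauchy_limit[OF complete, of "a g"] by blast
  qed
  then obtain c where c: "\<And>g. a g \<longlonglongrightarrow> c g"
    by metis
  show ?thesis
  proof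
    fix g h
    have "a (g + h) n - a g n - a h n = D g h - smul (q ^ n) (D (zmult (N ^ n) g) (zmult (N ^ n) h))" for n
    proof (induction n)
      case 0
      show ?case by (simp add: a_def)
    next
      case (Suc n)
      let ?g = "zmult (N ^ n) g" and ?h = "zmult (N ^ n) h"
      have "a (g + h) (Suc n) - a g (Suc n) - a h (Suc n) =
          a (g + h) n - a g n - a h n + smul (q ^ Suc n) (d (?g + ?h) - d ?g - d ?h)"
        by (simp add: a_def scale_right_diff_distrib zmult.scale_right_distrib algebra_simps)
      also have "d (?g + ?h) - d ?g - d ?h = zmult N (D ?g ?h) - D (zmult N ?g) (zmult N ?h)"
        by (rule d_D[symmetric])
      also have "smul (q ^ Suc n) \<dots> = smul (q ^ n) (D ?g ?h) - smul (q ^ Suc n) (D (zmult N ?g) (zmult N ?h))"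
        using N(1) by (simp add: scale_right_diff_distrib q_def mult_ac flip: scale_of_int)
      finally show ?case
        by (simp add: Suc.IH)
    qed
    moreover have "(\<lambda>n. a (g + h) n - a g n - a h n) \<longlonglongrightarrow> c (g + h) - c g - c h"
      by (intro tendsto_intros c)
    moreover have "(\<lambda>n. D g h - smul (q ^ n) (D (zmult (N ^ n) g) (zmult (N ^ n) h))) \<longlonglongrightarrow> D g h - 0"
      unfolding q using N(1) by (intro tendsto_intros bounded_inverse_powers[OF B(2)] D) auto
    ultimately have "c (g + h) - c g - c h = D g h"
      using LIMSEQ_unique by fastforce
    then show "c (g + h) = c g + c h + D g h"
      by (simp add: algebra_simps)
  next
    fix g
    have "(\<lambda>n. c g - a g n) \<longlonglongrightarrow> c g - c g"
      by (intro tendsto_intros c)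
    then have "\<forall>\<^sub>F n in sequentially. c g - a g n \<in> B"
      using B(1) by (intro topological_tendstoD) (auto simp: sym_nbhd_def)
    then obtain n where "c g - a g n \<in> B"
      by (auto simp: eventually_sequentially)
    moreover have "a g n \<in> B"
      unfolding a_def by (rule sum_in_B) (rule d)
    moreover have "c g = a g n + (c g - a g n)"
      by simp
    ultimately show "\<exists>a\<in>B. \<exists>b\<in>B. c g = a + b"
      by blast
  next
    fix g assume "\<forall>n. d (zmult (N ^ n) g) = 0"
    then have "a g = (\<lambda>_. 0)"
      by (simp add: a_def fun_eq_iff)
    with c[of g] show "c g = 0"
      by (simp add: LIMSEQ_const_iff)
  qed
qed


section \<open>One-parameter subgroups\<close>

definition one_param :: "(real \<Rightarrow> 'a::topological_ab_group_add) \<Rightarrow> bool" where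
  "one_param \<phi> \<longleftrightarrow> Modules.additive \<phi> \<and> continuous_on UNIV \<phi>"

text \<open>
  In a torsion-free group the value at \<open>1\<close> determines a homomorphism on the rationals, and hence a
  continuous one on the reals. This is what turns a choice of one-parameter subgroups into a vector
  space structure: each axiom is an equality of two of them.
\<close>

lemma one_param_unique:
  fixes \<phi> \<psi> :: "real \<Rightarrow> 'a::{topological_ab_group_add, t2_space}"
  assumes torsion_free: "\<And>n (x::'a). n > 0 \<Longrightarrow> zmult n x = 0 \<Longrightarrow> x = 0"
    and \<phi>: "one_param \<phi>" and \<psi>: "one_param \<psi>" and "\<phi> 1 = \<psi> 1"
  shows "\<phi> t = \<psi> t"
proof -
  have add: "Modules.additive \<phi>" "Modules.additive \<psi>"
    using \<phi> \<psi> by (auto simp: one_param_def)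
  have "\<phi> t = \<psi> t" if rat: "t \<in> \<rat>" for t
  proof -
    obtain a b where ab: "b > 0" "t = of_int a / of_int b"
      using rat by (metis Rats_cases')
    then have t: "zmult b t = zmult a 1"
      by (simp add: zmult_real)
    have "zmult b (\<phi> t - \<psi> t) = \<phi> (zmult b t) - \<psi> (zmult b t)"
      by (simp add: additive_zmult[OF add(1)] additive_zmult[OF add(2)] zmult.scale_right_diff_distrib)
    also have "\<dots> = zmult a (\<phi> 1 - \<psi> 1)"
      by (simp only: t additive_zmult[OF add(1)] additive_zmult[OF add(2)] zmult.scale_right_diff_distrib)
    finally show ?thesis
      using torsion_free[OF ab(1), of "\<phi> t - \<psi> t"] assms(4) by simp
  qed
  then have "\<rat> \<subseteq> {t. \<phi> t = \<psi> t}"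
    by blast
  moreover have "closed {t. \<phi> t = \<psi> t}"
    using \<phi> \<psi> by (intro closed_Collect_eq) (auto simp: one_param_def)
  ultimately have "closure \<rat> \<subseteq> {t. \<phi> t = \<psi> t}"
    by (rule closure_minimal)
  then show ?thesis
    by (auto simp: Rats_closure_real)
qed

lemma (in topological_vector_space) torsion_free:
  fixes x :: 'a
  shows "n > 0 \<Longrightarrow> zmult n x = 0 \<Longrightarrow> x = 0"
  by (simp flip: scale_of_int)

lemma (in topological_vector_space) one_param_smul: "one_param (\<lambda>t. smul t x)"
  unfolding one_param_def
  by (auto simp: Modules.additive_def scale_left_distrib continuous_on_def
      intro!: tendsto_smul tendsto_intros)

section \<open>Extensions of locally bounded spaces\<close>

locale lb_extension =
  fixes i :: "'y::{topological_ab_group_add, uniform_topological_group_add, t2_space}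
               \<Rightarrow> 'x::{topological_ab_group_add, t2_space}"
    and p :: "'x \<Rightarrow> 'z::{topological_ab_group_add, t2_space}"
    and smulY :: "real \<Rightarrow> 'y \<Rightarrow> 'y"
    and smulZ :: "real \<Rightarrow> 'z \<Rightarrow> 'z"
  assumes extension: "group_extension i p"
    and lb_Y: "locally_bounded_tvs smulY"
    and complete_Y: "complete (UNIV :: 'y set)"
    and lb_Z: "locally_bounded_tvs smulZ"
begin

sublocale Y: topological_vector_space smulY
  using lb_Y by (simp add: locally_bounded_tvs_def)

sublocale Z: topological_vector_space smulZ
  using lb_Z by (simp add: locally_bounded_tvs_def)

sublocale i: Modules.additive i
  using extension by (simp add: group_extension_def)

sublocale p: Modules.additive p
  using extension by (simp add: group_extension_def)

lemmas i_zmult = additive_zmult[OF i.additive_axioms]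
lemmas p_zmult = additive_zmult[OF p.additive_axioms]

lemma continuous_i: "continuous_on UNIV i"
  and continuous_p: "continuous_on UNIV p"
  using extension by (simp_all add: group_extension_def)

lemma i_eq_iff: "i y = i y' \<longleftrightarrow> y = y'"
  using extension by (auto simp: group_extension_def inj_eq)

lemma p_i [simp]: "p (i y) = 0"
  using extension by (auto simp: group_extension_def)

lemma kernel_p:
  assumes "p x = 0"
  obtains y where "x = i y"
proof -
  have "x \<in> range i"
    using assms extension by (simp add: group_extension_def)
  then show ?thesis
    using that by blast
qed

lemma open_image_p: "open U \<Longrightarrow> open (p ` U)"
  using extension by (auto simp: group_extension_def open_onto_image_def open_map_def)

lemma open_image_i: 
  assumes "open U"
  obtains G where "open G" "i ` U = range i \<inter> G"
  using assms extension by (auto simp: group_extension_def open_onto_image_def open_map_def openin_open)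

lemma torsion_free:
  fixes x :: 'x
  assumes "n > 0" "zmult n x = 0"
  shows "x = 0"
proof -
  have "p x = 0"
    using Z.torsion_free[OF assms(1)] assms(2) by (metis p_zmult p.zero)
  then obtain y where y: "x = i y"
    by (rule kernel_p)
  then have "zmult n y = 0"
    using assms(2) by (metis i_zmult i.zero i_eq_iff)
  with assms(1) have "y = 0"
    by (rule Y.torsion_free)
  then show ?thesis
    by (simp add: y i.zero)
qed

text \<open>
  The order of the choices matters: \<open>B\<close> is bounded, so some integer \<open>N\<close> satisfies
  \<open>(B + B) / N \<subseteq> B\<close>, and only then is \<open>W\<close> taken so small that sums of two multiples by at most \<open>N\<close>
  and two further elements of \<open>W\<close> meet the image of \<open>i\<close> inside \<open>i ` B\<close>. This is possible because \<open>i\<close>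
  is open onto its image. Sums of this shape are the errors of the quasi-additive lifts below.
\<close>

lemma slab_data_exist:
  obtains B N W where "sym_nbhd B" "tvs_bounded smulY B" "N \<ge> 2"
    "\<And>a b. a \<in> B \<Longrightarrow> b \<in> B \<Longrightarrow> smulY (inverse (of_int N)) (a + b) \<in> B"
    "sym_nbhd W"
    "\<And>j k a b c d y. 0 \<le> j \<Longrightarrow> j \<le> N \<Longrightarrow> 0 \<le> k \<Longrightarrow> k \<le> N \<Longrightarrow> a \<in> W \<Longrightarrow> b \<in> W \<Longrightarrow> c \<in> W \<Longrightarrow> d \<in> W \<Longrightarrow>
      zmult j a + zmult k b + c + d = i y \<Longrightarrow> y \<in> B"
proof -
  obtain U where U: "open U" "0 \<in> U" "tvs_bounded smulY U"
    using lb_Y by (auto simp: locally_bounded_tvs_def)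
  obtain B where B: "sym_nbhd B" "B \<subseteq> U"
    using U(1,2) by (rule sym_nbhd_subset)
  have bounded: "tvs_bounded smulY B"
    using U(3) B(2) by (rule Y.tvs_bounded_subset)
  obtain s where s: "s > 0" "\<And>t y. t > s \<Longrightarrow> y \<in> {a + b |a b. a \<in> B \<and> b \<in> B} \<Longrightarrow> smulY (inverse t) y \<in> B"
    by (rule Y.tvs_boundedD[OF Y.tvs_bounded_add[OF bounded bounded] sym_nbhdD(1,2)[OF B(1)]]) (rule that)
  define N where "N = max 2 (\<lfloor>s\<rfloor> + 1)"
  have N: "N \<ge> 2" "of_int N > s"
    unfolding N_def by linarith+
  obtain G where G: "open G" "i ` B = range i \<inter> G"
    using sym_nbhdD(1)[OF B(1)] by (rule open_image_i)
  have "i 0 \<in> range i \<inter> G"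
    using G(2) sym_nbhdD(2)[OF B(1)] by blast
  then have "0 \<in> G"
    by (simp add: i.zero)
  with G(1) obtain G2 where G2: "sym_nbhd G2" "\<And>v w. v \<in> G2 \<Longrightarrow> w \<in> G2 \<Longrightarrow> v + w \<in> G"
    by (rule sym_nbhd_add) (rule that)
  obtain G4 where G4: "sym_nbhd G4" "\<And>v w. v \<in> G4 \<Longrightarrow> w \<in> G4 \<Longrightarrow> v + w \<in> G2"
    using sym_nbhdD(1,2)[OF G2(1)] by (rule sym_nbhd_add) (rule that)
  obtain W where W: "sym_nbhd W" "\<And>k v. 0 \<le> k \<Longrightarrow> k \<le> N \<Longrightarrow> v \<in> W \<Longrightarrow> zmult k v \<in> G4"
    using sym_nbhdD(1,2)[OF G4(1)] by (rule sym_nbhd_zmult[where N = N]) (rule that)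
  have "y \<in> B" if "0 \<le> j" "j \<le> N" "0 \<le> k" "k \<le> N" "a \<in> W" "b \<in> W" "c \<in> W" "d \<in> W"
    "zmult j a + zmult k b + c + d = i y" for j k a b c d y
  proof -
    have "c \<in> G4" "d \<in> G4"
      using W(2)[of 1] N(1) that by auto
    then have "(zmult j a + zmult k b) + (c + d) \<in> G"
      using that by (intro G2 G4 W) auto
    then have "i y \<in> i ` B"
      unfolding G(2) using that(9) by (simp add: add.assoc)
    then show ?thesis
      by (auto simp: i_eq_iff)
  qed
  moreover have "smulY (inverse (of_int N)) (a + b) \<in> B" if "a \<in> B" "b \<in> B" for a b
    using s(2)[OF N(2)] that by blast
  ultimately show ?thesis
    using B(1) bounded N(1) W(1) by (intro that[of B N W])
qed

end

locale lb_extension_slab = lb_extension i p smulY smulZ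
  for i :: "'y::{topological_ab_group_add, uniform_topological_group_add, t2_space}
               \<Rightarrow> 'x::{topological_ab_group_add, t2_space}"
    and p :: "'x \<Rightarrow> 'z::{topological_ab_group_add, t2_space}"
    and smulY :: "real \<Rightarrow> 'y \<Rightarrow> 'y"
    and smulZ :: "real \<Rightarrow> 'z \<Rightarrow> 'z" +
  fixes B :: "'y set" and N :: int and W :: "'x set"
  assumes B: "sym_nbhd B" "tvs_bounded smulY B"
    and N: "N \<ge> 2" "\<And>a b. a \<in> B \<Longrightarrow> b \<in> B \<Longrightarrow> smulY (inverse (of_int N)) (a + b) \<in> B"
    and W: "sym_nbhd W"
    and W_small: "\<And>j k a b c d y. 0 \<le> j \<Longrightarrow> j \<le> N \<Longrightarrow> 0 \<le> k \<Longrightarrow> k \<le> N \<Longrightarrow>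
      a \<in> W \<Longrightarrow> b \<in> W \<Longrightarrow> c \<in> W \<Longrightarrow> d \<in> W \<Longrightarrow>
      zmult j a + zmult k b + c + d = i y \<Longrightarrow> y \<in> B"
begin

lemmas W_minus = sym_nbhdD(3)[OF W]
  and W_zero = sym_nbhdD(2)[OF W]
  and W_open = sym_nbhdD(1)[OF W]

text \<open>
  A substitute for a bounded neighbourhood of zero: modulo \<open>Y\<close> only the neighbourhood
  \<open>W\<close> constrains its elements, but along \<open>Y\<close> they stay bounded, because differences of elements
  of \<open>W\<close> meet the image of \<open>i\<close> inside \<open>i ` B\<close>.
\<close>

definition slab where
  "slab = {w + i (a + b) |w a b. w \<in> W \<and> a \<in> B \<and> b \<in> B}"

lemma slabI: "w \<in> W \<Longrightarrow> a \<in> B \<Longrightarrow> b \<in> B \<Longrightarrow> x = w + i (a + b) \<Longrightarrow> x \<in> slab"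
  by (auto simp: slab_def)

lemma slab_minus: "x \<in> slab \<Longrightarrow> - x \<in> slab"
  using W_minus sym_nbhdD(3)[OF B(1)] slabI[of "- w" "- a" "- b" "- x" for w a b]
  by (force simp: slab_def simp flip: i.minus)

lemma W_subset_slab: "w \<in> W \<Longrightarrow> w \<in> slab"
  using sym_nbhdD(2)[OF B(1)] by (auto intro!: slabI[of w 0 0] simp: i.zero)

text \<open>
  The source of all continuity and boundedness below. An element \<open>x\<close> with small image in \<open>Z\<close> has
  the form \<open>w' + i y\<close> with \<open>w'\<close> as small as desired. If \<open>n x\<close> lies in the slab, then \<open>n y\<close> lies in the
  bounded set \<open>B + B + B\<close>, so that \<open>y\<close> is small once \<open>n\<close> is large. Thus smallness in \<open>X\<close> can be read
  off from the image in \<open>Z\<close> and one multiple in the slab.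
\<close>

lemma slab_criterion:
  assumes U: "open U" "0 \<in> U"
  obtains n Q where "n > 0" "open Q" "0 \<in> Q" "\<And>x. p x \<in> Q \<Longrightarrow> zmult n x \<in> slab \<Longrightarrow> x \<in> U"
proof -
  obtain U1 where U1: "sym_nbhd U1" "\<And>v w. v \<in> U1 \<Longrightarrow> w \<in> U1 \<Longrightarrow> v + w \<in> U"
    using U by (rule sym_nbhd_add) (rule that)
  have "open (i -` U1)" "0 \<in> i -` U1"
    using open_vimage[OF sym_nbhdD(1)[OF U1(1)] continuous_i] sym_nbhdD(2)[OF U1(1)]
    by (auto simp: i.zero)
  then obtain s where s: "s > 0" "\<And>t y. t > s \<Longrightarrow>
      y \<in> {b + c |b c. b \<in> B \<and> c \<in> {a + b |a b. a \<in> B \<and> b \<in> B}} \<Longrightarrow> smulY (inverse t) y \<in> i -` U1"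
    by (rule Y.tvs_boundedD[OF Y.tvs_bounded_add[OF B(2) Y.tvs_bounded_add[OF B(2) B(2)]]]) (rule that)
  define n where "n = \<lfloor>s\<rfloor> + 1"
  have n: "n > 0" "of_int n > s"
    unfolding n_def using s(1) by linarith+
  define W2 where "W2 = W \<inter> U1 \<inter> zmult n -` W"
  have "open W2" "0 \<in> W2"
    using W_open W_zero sym_nbhdD(1,2)[OF U1(1)] open_vimage[OF W_open continuous_on_zmult]
    by (auto simp: W2_def)
  moreover have "x \<in> U" if x: "p x \<in> p ` W2" "zmult n x \<in> slab" for x
  proof -
    obtain w' where w': "w' \<in> W2" "p x = p w'"
      using x(1) by blast
    then have "p (x - w') = 0"
      by (simp add: p.diff)
    then obtain y where "x - w' = i y"
      by (rule kernel_p)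
    then have y: "x = w' + i y"
      by (simp add: algebra_simps)
    obtain w a b where w: "w \<in> W" "a \<in> B" "b \<in> B" "zmult n x = w + i (a + b)"
      using x(2) by (auto simp: slab_def)
    define c where "c = zmult n y - (a + b)"
    have "zmult 0 0 + zmult 0 0 + w + - zmult n w' = i c"
      using w(4) by (simp add: c_def y i.diff i_zmult zmult.scale_right_distrib algebra_simps)
    then have "c \<in> B"
      using N(1) w(1) w'(1) by (intro W_small[of 0 0 0 0 w "- zmult n w'" c]) (auto simp: W2_def W_zero W_minus)
    moreover have "y = smulY (inverse (of_int n)) (c + (a + b))"
      using n(1) by (simp add: c_def flip: Y.scale_of_int)
    ultimately have "i y \<in> U1"
      using s(2)[OF n(2)] w(2,3) by blast
    then show "x \<in> U"
      unfolding y using w'(1) by (intro U1(2)) (auto simp: W2_def)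
  qed
  ultimately show ?thesis
    using n(1) by (intro that[of n "p ` W2"]) (auto simp: open_image_p image_iff p.zero intro: bexI[of _ 0])
qed

text \<open>
  For small \<open>t\<close> the multiple \<open>n \<phi>(t) = \<phi>(n t)\<close> is still in the slab, so \<open>slab_criterion\<close> gives
  continuity at zero.
\<close>

lemma one_param_criterion:
  assumes add: "Modules.additive \<phi>" and p\<phi>: "\<And>t. p (\<phi> t) = smulZ t z"
    and slab: "\<And>t. \<bar>t\<bar> \<le> 1 \<Longrightarrow> \<phi> t \<in> slab"
  shows "one_param \<phi>"
  unfolding one_param_def
proof (intro conjI add continuous_on_additiveI)
  fix U :: "'x set" assume "open U" "0 \<in> U"
  then obtain n Q where n: "n > 0" and Q: "open Q" "0 \<in> Q"
    and crit: "\<And>x. p x \<in> Q \<Longrightarrow> zmult n x \<in> slab \<Longrightarrow> x \<in> U"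
    by (rule slab_criterion) (rule that)
  define V where "V = {-1 / of_int n <..< 1 / of_int n} \<inter> (\<lambda>t. smulZ t z) -` Q"
  have "open ((\<lambda>t. smulZ t z) -` Q)"
    using Z.one_param_smul by (intro open_vimage[OF Q(1)]) (simp add: one_param_def)
  then have "open V" "0 \<in> V"
    using Q(2) n by (auto simp: V_def)
  moreover have "\<phi> t \<in> U" if "t \<in> V" for t
  proof (rule crit)
    have "\<bar>of_int n * t\<bar> \<le> 1"
      using that n by (auto simp: V_def field_simps abs_le_iff)
    then have "\<phi> (of_int n * t) \<in> slab"
      by (rule slab)
    then show "zmult n (\<phi> t) \<in> slab"
      by (simp add: additive_zmult[OF add, symmetric] zmult_real)
  qed (use that in \<open>simp add: V_def p\<phi>\<close>)
  ultimately show "\<exists>V. open V \<and> 0 \<in> V \<and> (\<forall>v\<in>V. \<phi> v \<in> U)"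
    by blast
qed

text \<open>
  Lift \<open>t p(x)\<close> into \<open>W\<close> for \<open>0 \<le> t < 1\<close> and extend by \<open>s(t) = \<lfloor>t\<rfloor> x + l(frac t)\<close>. The integer parts
  contribute at most \<open>N\<close> copies of \<open>x\<close> to the errors \<open>s(t + u) - s(t) - s(u)\<close> and \<open>N s(t) - s(N t)\<close>;
  these errors lie over \<open>0\<close>, so they come from \<open>B\<close>. Then \<open>bounded_cocycle_trivial\<close> corrects \<open>s\<close>
  by a bounded map into \<open>Y\<close> to an additive map. On the powers of \<open>N\<close> the map \<open>s\<close> is already
  homogeneous, so the correction does not move the value at \<open>1\<close>.
\<close>

lemma one_param_small:
  assumes x: "x \<in> W" and small: "\<And>t. \<bar>t\<bar> \<le> 1 \<Longrightarrow> smulZ t (p x) \<in> p ` W"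
  obtains \<phi> where "one_param \<phi>" "\<phi> 1 = x" "\<And>t. \<bar>t\<bar> \<le> 1 \<Longrightarrow> \<phi> t \<in> slab"
proof -
  \<comment> \<open>The normalisation at \<open>0\<close> makes the lift exact on the integers.\<close>
  have "\<exists>w\<in>W. p w = smulZ t (p x) \<and> (t = 0 \<longrightarrow> w = 0)" if "0 \<le> t" "t < 1" for t
  proof (cases "t = 0")
    case True
    then show ?thesis by (intro bexI[of _ 0]) (auto simp: p.zero W_zero)
  next
    case False
    then show ?thesis using small[of t] that by force
  qed
  then obtain l where l: "\<And>t. 0 \<le> t \<Longrightarrow> t < 1 \<Longrightarrow> l t \<in> W"
      "\<And>t. 0 \<le> t \<Longrightarrow> t < 1 \<Longrightarrow> p (l t) = smulZ t (p x)" "l 0 = 0"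
    by (metis zero_less_one order_refl)
  have lW: "l (frac t) \<in> W" for t
    by (intro l(1) frac_ge_0 frac_lt_1)
  define s where "s t = zmult \<lfloor>t\<rfloor> x + l (frac t)" for t
  have p_s: "p (s t) = smulZ t (p x)" for t
  proof -
    have "p (s t) = smulZ (of_int \<lfloor>t\<rfloor>) (p x) + smulZ (frac t) (p x)"
      by (simp add: s_def p.add p_zmult l(2) frac_lt_1 Z.scale_of_int)
    also have "\<dots> = smulZ (of_int \<lfloor>t\<rfloor> + frac t) (p x)"
      by (simp add: Z.scale_left_distrib)
    finally show ?thesis
      by (simp add: frac_def)
  qed
  have "\<exists>y\<in>B. s (t + u) - s t - s u = i y" for t u
  proof -
    have "p (s (t + u) - s t - s u) = 0"
      by (simp add: p.diff p_s Z.scale_left_distrib)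
    then obtain y where y: "s (t + u) - s t - s u = i y"
      by (rule kernel_p)
    define c where "c = \<lfloor>t + u\<rfloor> - \<lfloor>t\<rfloor> - \<lfloor>u\<rfloor>"
    have c: "0 \<le> c" "c \<le> 1"
      unfolding c_def by linarith+
    have "zmult c x + zmult 1 (l (frac (t + u))) + - l (frac t) + - l (frac u) = i y"
      unfolding y[symmetric] by (simp add: c_def s_def zmult.scale_left_diff_distrib algebra_simps)
    then have "y \<in> B"
      using c N(1) x lW W_minus
      by (intro W_small[of c 1 x "l (frac (t + u))" "- l (frac t)" "- l (frac u)"]) auto
    with y show ?thesis by blast
  qed
  then obtain D where D: "\<And>t u. D t u \<in> B" "\<And>t u. s (t + u) - s t - s u = i (D t u)"
    by metis
  have "\<exists>y\<in>B. zmult N (s t) - s (zmult N t) = i y" for t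
  proof -
    have "p (zmult N (s t) - s (zmult N t)) = 0"
      by (simp add: p.diff p_zmult p_s zmult_real flip: Z.scale_of_int)
    then obtain y where y: "zmult N (s t) - s (zmult N t) = i y"
      by (rule kernel_p)
    define c where "c = \<lfloor>of_int N * t\<rfloor> - N * \<lfloor>t\<rfloor>"
    have c: "c = \<lfloor>of_int N * frac t\<rfloor>"
      by (simp add: c_def frac_def right_diff_distrib flip: of_int_mult)
    have "of_int N * frac t \<le> of_int N * 1"
      using N(1) frac_lt_1[of t] by (intro mult_left_mono) auto
    then have "of_int N * frac t < of_int N + 1"
      by linarith
    then have c01: "0 \<le> c" "c \<le> N"
      unfolding c using N(1) by (auto simp: floor_le_iff)
    have "zmult N (l (frac t)) + zmult c (- x) + - l (frac (zmult N t)) + 0 = i y"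
      unfolding y[symmetric]
      by (simp add: c_def s_def zmult_real zmult.scale_left_diff_distrib zmult.scale_right_distrib algebra_simps)
    then have "y \<in> B"
      using c01 N(1) x lW W_minus W_zero by (intro W_small[of N c "l (frac t)" "- x" "- l (frac (zmult N t))" 0]) auto
    with y show ?thesis by blast
  qed
  then obtain d where d: "\<And>t. d t \<in> B" "\<And>t. zmult N (s t) - s (zmult N t) = i (d t)"
    by metis
  have rel: "zmult N (D t u) - D (zmult N t) (zmult N u) = d (t + u) - d t - d u" for t u
  proof -
    have "i (zmult N (D t u) - D (zmult N t) (zmult N u)) = i (d (t + u) - d t - d u)"
      by (simp add: i.diff i_zmult zmult.scale_right_diff_distrib zmult.scale_right_distrib
          flip: d(2) D(2))
    then show ?thesis
      by (simp add: i_eq_iff)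
  qed
  obtain c where c: "\<And>t u. c (t + u) = c t + c u + D t u"
      "\<And>t. \<exists>a\<in>B. \<exists>b\<in>B. c t = a + b"
      "\<And>t. \<forall>n. d (zmult (N ^ n) t) = 0 \<Longrightarrow> c t = 0"
    by (rule bounded_cocycle_trivial[OF Y.topological_vector_space_axioms complete_Y B N d(1) D(1) rel])
       (assumption, assumption, rule that)
  define \<phi> where "\<phi> t = s t - i (c t)" for t
  have add: "Modules.additive \<phi>"
  proof
    show "\<phi> (t + u) = \<phi> t + \<phi> u" for t u
      using D(2)[of t u] by (simp add: \<phi>_def c(1) i.add algebra_simps)
  qed
  have s_int: "s (of_int k) = zmult k x" for k
    by (simp add: s_def l(3))
  have "d (zmult (N ^ n) 1) = 0" for n
  proof -
    have "i (d (zmult (N ^ n) 1)) = zmult N (s (of_int (N ^ n))) - s (of_int (N ^ Suc n))"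
      by (simp add: zmult_real flip: d(2))
    also have "\<dots> = i 0"
      unfolding s_int by (simp add: i.zero)
    finally show ?thesis
      by (simp only: i_eq_iff)
  qed
  then have "\<phi> 1 = x"
    using c(3)[of 1] s_int[of 1] by (simp add: \<phi>_def i.zero)
  have unit: "\<phi> t \<in> slab" if t: "0 \<le> t" "t < 1" for t
  proof -
    obtain a b where "a \<in> B" "b \<in> B" "c t = a + b"
      using c(2) by blast
    moreover have "s t = l t"
      using t floor_unique[of 0 t] by (simp add: s_def frac_def)
    ultimately show ?thesis
      using l(1)[OF t] sym_nbhdD(3)[OF B(1)]
      by (intro slabI[of "l t" "- a" "- b"]) (auto simp: \<phi>_def i.add i.minus i.diff)
  qed
  have slab: "\<phi> t \<in> slab" if "\<bar>t\<bar> \<le> 1" for t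
  proof -
    have "\<phi> \<bar>t\<bar> \<in> slab"
      using unit[of "\<bar>t\<bar>"] that W_subset_slab[OF x] \<open>\<phi> 1 = x\<close> by (cases "\<bar>t\<bar> = 1") auto
    then show ?thesis
      using slab_minus[of "\<phi> (- t)"] additive.minus[OF add, of t] by (cases "t \<ge> 0") auto
  qed
  have "one_param \<phi>"
    using slab by (intro one_param_criterion[OF add, of "p x"]) (auto simp: \<phi>_def p.diff p_s)
  with \<open>\<phi> 1 = x\<close> slab show ?thesis
    by (rule that[rotated]) 
qed

lemma slab_nbhd:
  obtains V where "open V" "0 \<in> V"
    "\<And>x. x \<in> V \<Longrightarrow> \<exists>\<phi>. one_param \<phi> \<and> \<phi> 1 = x \<and> (\<forall>t. \<bar>t\<bar> \<le> 1 \<longrightarrow> \<phi> t \<in> slab)"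
proof -
  have "0 \<in> p ` W"
    using W_zero p.zero by force
  then obtain Q where Q: "open Q" "0 \<in> Q" "\<And>r z. z \<in> Q \<Longrightarrow> \<bar>r\<bar> \<le> 1 \<Longrightarrow> smulZ r z \<in> p ` W"
    by (rule Z.balanced_nbhd[OF open_image_p[OF W_open]]) (rule that)
  show ?thesis
  proof
    show "open (W \<inter> p -` Q)" "0 \<in> W \<inter> p -` Q"
      using W_open W_zero open_vimage[OF Q(1) continuous_p] Q(2) by (auto simp: p.zero)
    fix x assume "x \<in> W \<inter> p -` Q"
    then show "\<exists>\<phi>. one_param \<phi> \<and> \<phi> 1 = x \<and> (\<forall>t. \<bar>t\<bar> \<le> 1 \<longrightarrow> \<phi> t \<in> slab)"
      using one_param_small[of x] Q(3) by (metis IntD1 IntD2 vimageD)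
  qed
qed

text \<open>
  For a large integer \<open>n\<close> the vector \<open>p(x) / n\<close> lifts to a small \<open>v\<close>, so that \<open>x = n v + i y\<close> for
  some \<open>y\<close>. The subgroup through \<open>x\<close> is then \<open>n\<close> times the one through \<open>v\<close> plus the image of the
  line through \<open>y\<close>.
\<close>

lemma one_param_exists:
  fixes x :: 'x
  shows "\<exists>\<phi>. one_param \<phi> \<and> \<phi> 1 = x"
proof -
  obtain V where V: "open V" "0 \<in> V"
    "\<And>x. x \<in> V \<Longrightarrow> \<exists>\<phi>. one_param \<phi> \<and> \<phi> 1 = x \<and> (\<forall>t. \<bar>t\<bar> \<le> 1 \<longrightarrow> \<phi> t \<in> slab)"
    by (rule slab_nbhd) (rule that)
  have "0 \<in> p ` V"
    using V(2) p.zero by force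
  then obtain s where s: "s > 0" "\<And>t z. t > s \<Longrightarrow> z \<in> {p x} \<Longrightarrow> smulZ (inverse t) z \<in> p ` V"
    by (rule Z.tvs_boundedD[OF Z.tvs_bounded_singleton open_image_p[OF V(1)]]) (rule that)
  define n where "n = \<lfloor>s\<rfloor> + 1"
  have n: "n > 0" "of_int n > s"
    unfolding n_def using s(1) by linarith+
  obtain v where v: "v \<in> V" "smulZ (inverse (of_int n)) (p x) = p v"
    using s(2)[OF n(2)] by blast
  have "p (zmult n v) = p x"
    using n(1) by (simp add: p_zmult flip: v(2) Z.scale_of_int)
  then have "p (x - zmult n v) = 0"
    by (simp add: p.diff)
  then obtain y where "x - zmult n v = i y"
    by (rule kernel_p)
  then have y: "x = zmult n v + i y"
    by (simp add: algebra_simps)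
  obtain \<phi> where \<phi>: "one_param \<phi>" "\<phi> 1 = v"
    using V(3)[OF v(1)] by blast
  have "one_param (\<lambda>t. zmult n (\<phi> t) + i (smulY t y))"
    using \<phi>(1) Y.one_param_smul[of y]
    by (auto simp: one_param_def Modules.additive_def i.add zmult.scale_right_distrib algebra_simps
        intro!: continuous_intros continuous_on_compose2[OF continuous_on_zmult]
        continuous_on_compose2[OF continuous_i])
  then show ?thesis
    using \<phi>(2) by (intro exI[of _ "\<lambda>t. zmult n (\<phi> t) + i (smulY t y)"]) (simp add: y)
qed

text \<open>
  By \<open>one_param_unique\<close> and \<open>torsion_free\<close> the chosen subgroup is the only one through \<open>x\<close>.
\<close>

definition smulX :: "real \<Rightarrow> 'x \<Rightarrow> 'x" where
  "smulX t x = (SOME \<phi>. one_param \<phi> \<and> \<phi> 1 = x) t"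

lemma one_param_smulX: "one_param (\<lambda>t. smulX t x)"
  and smulX_one: "smulX 1 x = x"
  unfolding smulX_def using someI_ex[OF one_param_exists[of x]] by auto

lemma smulX_eqI:
  assumes "one_param \<phi>" "\<phi> 1 = x"
  shows "smulX t x = \<phi> t"
  by (rule one_param_unique[OF torsion_free one_param_smulX]) (use assms in \<open>auto simp: smulX_one\<close>)

lemma smulX_add: "smulX (r + t) x = smulX r x + smulX t x"
  using one_param_smulX[of x] by (simp add: one_param_def Modules.additive_def)

lemma vector_space_smulX: "vector_space smulX"
proof
  fix r t x y
  show "smulX r (x + y) = smulX r x + smulX r y"
    using one_param_smulX[of x] one_param_smulX[of y]
    by (intro smulX_eqI[of "\<lambda>r. smulX r x + smulX r y"])
       (auto simp: one_param_def Modules.additive_def smulX_one algebra_simps intro!: continuous_intros)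
  show "smulX (r + t) x = smulX r x + smulX t x"
    by (rule smulX_add)
  \<comment> \<open>Reparametrising the line through \<open>x\<close> gives the line through \<open>t x\<close>.\<close>
  show "smulX r (smulX t x) = smulX (r * t) x"
    using one_param_smulX[of x]
    by (intro smulX_eqI[of "\<lambda>r. smulX (r * t) x"])
       (auto simp: one_param_def Modules.additive_def smulX_add distrib_right
         intro!: continuous_intros continuous_on_compose2[of UNIV "\<lambda>r. smulX r x"])
  show "smulX 1 x = x"
    by (rule smulX_one)
qed

lemma smulX_i: "smulX t (i y) = i (smulY t y)"
  using Y.one_param_smul[of y]
  by (intro smulX_eqI[of "\<lambda>t. i (smulY t y)"])
     (auto simp: one_param_def Modules.additive_def i.add intro!: continuous_on_compose2[OF continuous_i])

lemma p_smulX: "p (smulX t x) = smulZ t (p x)"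
proof (rule one_param_unique[OF Z.torsion_free])
  show "one_param (\<lambda>t. p (smulX t x))"
    using one_param_smulX[of x]
    by (auto simp: one_param_def Modules.additive_def p.add intro!: continuous_on_compose2[OF continuous_p])
qed (auto simp: Z.one_param_smul smulX_one)

lemma smulX_slab:
  obtains V where "open V" "0 \<in> V" "\<And>x t. x \<in> V \<Longrightarrow> \<bar>t\<bar> \<le> 1 \<Longrightarrow> smulX t x \<in> slab"
  using slab_nbhd smulX_eqI by metis

text \<open>
  Equicontinuity on \<open>[-1, 1]\<close>: by \<open>slab_criterion\<close> it is enough that \<open>t p(v)\<close> is small, which
  holds by a balanced neighbourhood in \<open>Z\<close>, and that \<open>n (t v) = t (n v)\<close> lies in the slab.
\<close>

lemma tvs_smulX: "topological_vector_space smulX"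
proof (rule topological_vector_spaceI[OF vector_space_smulX])
  interpret X: vector_space smulX
    by (rule vector_space_smulX)
  show "continuous_on UNIV (\<lambda>r. smulX r x)" for x
    using one_param_smulX by (simp add: one_param_def)
  fix U :: "'x set" assume "open U" "0 \<in> U"
  then obtain n Q where n: "n > 0" and Q: "open Q" "0 \<in> Q"
    and crit: "\<And>x. p x \<in> Q \<Longrightarrow> zmult n x \<in> slab \<Longrightarrow> x \<in> U"
    by (rule slab_criterion) (rule that)
  obtain Q' where Q': "open Q'" "0 \<in> Q'" "\<And>r z. z \<in> Q' \<Longrightarrow> \<bar>r\<bar> \<le> 1 \<Longrightarrow> smulZ r z \<in> Q"
    using Q by (rule Z.balanced_nbhd) (rule that)
  obtain V where V: "open V" "0 \<in> V" "\<And>x t. x \<in> V \<Longrightarrow> \<bar>t\<bar> \<le> 1 \<Longrightarrow> smulX t x \<in> slab"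
    by (rule smulX_slab) (rule that)
  show "\<exists>V. open V \<and> 0 \<in> V \<and> (\<forall>v\<in>V. \<forall>r. \<bar>r\<bar> \<le> 1 \<longrightarrow> smulX r v \<in> U)"
  proof (intro exI conjI ballI allI impI)
    show "open (zmult n -` V \<inter> p -` Q')"
      by (intro open_Int open_vimage[OF V(1) continuous_on_zmult] open_vimage[OF Q'(1) continuous_p])
    show "0 \<in> zmult n -` V \<inter> p -` Q'"
      using V(2) Q'(2) by (simp add: p.zero)
    fix v r assume v: "v \<in> zmult n -` V \<inter> p -` Q'" and r: "\<bar>r\<bar> \<le> (1::real)"
    show "smulX r v \<in> U"
    proof (rule crit)
      show "p (smulX r v) \<in> Q"
        using v r Q'(3) by (simp add: p_smulX)
      have "zmult n (smulX r v) = smulX r (zmult n v)"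
        by (simp add: mult.commute flip: X.scale_of_int)
      then show "zmult n (smulX r v) \<in> slab"
        using v r V(3) by simp
    qed
  qed
qed

text \<open>
  Take \<open>x\<close> with bounded image in \<open>Z\<close> and with \<open>t x\<close> in the slab for \<open>\<bar>t\<bar> \<le> 1\<close>. For \<open>t \<ge> n\<close> the
  multiple \<open>n (x / t) = (n / t) x\<close> is in the slab, so \<open>slab_criterion\<close> applies to \<open>x / t\<close>.
\<close>

lemma locally_bounded_smulX: "locally_bounded_tvs smulX"
proof -
  interpret X: topological_vector_space smulX
    by (rule tvs_smulX)
  obtain V where V: "open V" "0 \<in> V" "\<And>x t. x \<in> V \<Longrightarrow> \<bar>t\<bar> \<le> 1 \<Longrightarrow> smulX t x \<in> slab"
    by (rule smulX_slab) (rule that)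
  obtain Q where Q: "open Q" "0 \<in> Q" "tvs_bounded smulZ Q"
    using lb_Z by (auto simp: locally_bounded_tvs_def)
  have "tvs_bounded smulX (V \<inter> p -` Q)"
    unfolding X.tvs_bounded_iff
  proof (intro allI impI)
    fix U :: "'x set" assume "open U \<and> 0 \<in> U"
    then obtain n Q' where n: "n > 0" and Q': "open Q'" "0 \<in> Q'"
      and crit: "\<And>x. p x \<in> Q' \<Longrightarrow> zmult n x \<in> slab \<Longrightarrow> x \<in> U"
      using slab_criterion[of U] by metis
    obtain s where s: "s > 0" "\<And>t z. t > s \<Longrightarrow> z \<in> Q \<Longrightarrow> smulZ (inverse t) z \<in> Q'"
      using Q(3) Q' by (rule Z.tvs_boundedD) (rule that)
    have "smulX (inverse t) x \<in> U" if t: "t > max s (of_int n)" and x: "x \<in> V \<inter> p -` Q" for t x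
    proof (rule crit)
      show "p (smulX (inverse t) x) \<in> Q'"
        using s(2) t x by (simp add: p_smulX)
      have "\<bar>of_int n / t\<bar> \<le> 1"
        using t n by simp
      then show "zmult n (smulX (inverse t) x) \<in> slab"
        using V(3)[of x "of_int n / t"] x by (simp add: divide_inverse flip: X.scale_of_int)
    qed
    then show "\<exists>s>0. \<forall>t>s. \<forall>b\<in>V \<inter> p -` Q. smulX (inverse t) b \<in> U"
      using s(1) by (intro exI[of _ "max s (of_int n)"]) auto
  qed
  moreover have "open (V \<inter> p -` Q)" "0 \<in> V \<inter> p -` Q"
    using V(1,2) Q(2) open_vimage[OF Q(1) continuous_p] by (auto simp: p.zero)
  ultimately show ?thesis
    using tvs_smulX by (auto simp: locally_bounded_tvs_def)
qed

lemma tvs_extension_smulX: "tvs_extension smulY smulX smulZ i p"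
proof -
  interpret X: topological_vector_space smulX
    by (rule tvs_smulX)
  have "Vector_Spaces.linear smulY smulX i" "Vector_Spaces.linear smulX smulZ p"
    by unfold_locales (simp_all add: i.add p.add smulX_i p_smulX)
  then show ?thesis
    unfolding tvs_extension_def
    using extension tvs_smulX Y.topological_vector_space_axioms Z.topological_vector_space_axioms by simp
qed

end

theorem theorem25:
  fixes i :: "'y::{topological_ab_group_add, uniform_topological_group_add, t2_space}
               \<Rightarrow> 'x::{topological_ab_group_add, t2_space}"
    and p :: "'x \<Rightarrow> 'z::{topological_ab_group_add, t2_space}"
    and smulY :: "real \<Rightarrow> 'y \<Rightarrow> 'y"
    and smulZ :: "real \<Rightarrow> 'z \<Rightarrow> 'z"
  assumes "group_extension i p"
    and "locally_bounded_tvs smulY"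
    and "complete (UNIV :: 'y set)"
    and "locally_bounded_tvs smulZ"
  shows "\<exists>smulX :: real \<Rightarrow> 'x \<Rightarrow> 'x.
           tvs_extension smulY smulX smulZ i p \<and> locally_bounded_tvs smulX"
proof -
  interpret lb_extension i p smulY smulZ
    using assms by unfold_locales
  obtain B N W where "lb_extension_slab i p smulY smulZ B N W"
  proof (rule slab_data_exist)
    fix B N W
    assume "sym_nbhd B" "tvs_bounded smulY B" "N \<ge> 2"
      "\<And>a b. a \<in> B \<Longrightarrow> b \<in> B \<Longrightarrow> smulY (inverse (of_int N)) (a + b) \<in> B" "sym_nbhd W"
      "\<And>j k a b c d y. 0 \<le> j \<Longrightarrow> j \<le> N \<Longrightarrow> 0 \<le> k \<Longrightarrow> k \<le> N \<Longrightarrow> a \<in> W \<Longrightarrow> b \<in> W \<Longrightarrow> c \<in> W \<Longrightarrow> d \<in> W \<Longrightarrow>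
        zmult j a + zmult k b + c + d = i y \<Longrightarrow> y \<in> B"
    then have "lb_extension_slab i p smulY smulZ B N W"
      by unfold_locales
    then show thesis
      by (rule that)
  qed
  then interpret lb_extension_slab i p smulY smulZ B N W .
  show ?thesis
    using tvs_extension_smulX locally_bounded_smulX by blast
qed

end
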